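(* Let $P$ be a simple $d$-polytope, let $2\le k\le d-1$, and let $\mathcal{S}$ be a $k$-system of $\mathcal{G}_P$. Then exactly one of the following two cases occurs: (a) there is an acyclic orientation $\mathcal{O}$ of $\mathcal{G}_P$ with $\mathcal{H}_k(\mathcal{O})=|\mathcal{S}|$; (b) there is a $k$-system $\mathcal{S}'$ of $\mathcal{G}_P$ with $|\mathcal{S}'|>|\mathcal{S}|$. In case (a), $\mathcal{S}=\mathcal{V}_k(P)$; in case (b), $\mathcal{S}\neq\mathcal{V}_k(P)$.
   Context: A $d$-polytope $P$ is simple if every vertex of $P$ is contained in exactly $d$ edges. $\mathcal{G}_P=(\mathcal{V}(P),\mathcal{E}(P))$ denotes the abstract vertex-edge graph of $P$. For $W\subseteq\mathcal{V}(P)$, $\mathcal{G}_P(W)$ is the subgraph of $\mathcal{G}_P$ induced by $W$. $\mathcal{V}_k(P)$ is the set of vertex sets of the $k$-faces ($k$-dimensional faces) of $P$. For $2\le k\le d-1$, a $k$-frame of $P$ is a (not necessarily induced) subgraph of $\mathcal{G}_P$ isomorphic to the star $K_{1,k}$. A set $\mathcal{S}$ of non-empty subsets of $\mathcal{V}(P)$ is a $k$-system of $\mathcal{G}_P$ if for every $S\in\mathcal{S}$ the induced subgraph $\mathcal{G}_P(S)$ is $k$-regular, and the node set of every $k$-frame of $P$ is contained in a unique set from $\mathcal{S}$. For an acyclic orientation $\mathcal{O}$ of $\mathcal{G}_P$ (no directed cycles) and $0\le i\le d$, $h_i(\mathcal{O})$ is the number of vertices of $\mathcal{G}_P$ with precisely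 $i$ of their incident edges directed inwards, and $\mathcal{H}_k(\mathcal{O})=\sum_{i=0}^d h_i(\mathcal{O})\binom{i}{k}$. *)

theory Defs
  imports "HOL-Analysis.Analysis"
begin

section \<open>Graphs\<close>

text \<open>A graph is a node set together with a set of edges, each edge being the set of its two
  end nodes.\<close>

type_synonym 'a graph = "'a set \<times> 'a set set"

abbreviation nodes :: "'a graph \<Rightarrow> 'a set" where "nodes G \<equiv> fst G"

abbreviation edges :: "'a graph \<Rightarrow> 'a set set" where "edges G \<equiv> snd G"

definition subgraph_of :: "'a graph \<Rightarrow> 'a graph \<Rightarrow> bool" where
  "subgraph_of H G \<longleftrightarrow>
     nodes H \<subseteq> nodes G \<and> edges H \<subseteq> edges G \<and> (\<forall>e \<in> edges H. e \<subseteq> nodes H)"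

definition induced_subgraph :: "'a graph \<Rightarrow> 'a set \<Rightarrow> 'a graph" where
  "induced_subgraph G W = (W, {e \<in> edges G. e \<subseteq> W})"

definition graph_isomorphic :: "'a graph \<Rightarrow> 'b graph \<Rightarrow> bool" where
  "graph_isomorphic G H \<longleftrightarrow>
     (\<exists>f. bij_betw f (nodes G) (nodes H) \<and> (\<lambda>e. f ` e) ` edges G = edges H)"

definition star_graph :: "nat \<Rightarrow> nat graph" where
  "star_graph k = ({0..k}, {{0, i} | i. i \<in> {1..k}})"

definition regular_graph :: "nat \<Rightarrow> 'a graph \<Rightarrow> bool" where
  "regular_graph k G \<longleftrightarrow> (\<forall>v \<in> nodes G. card {e \<in> edges G. v \<in> e} = k)"

text \<open>An orientation is the set of its arcs; the arc \<open>(u, v)\<close> is directed from \<open>u\<close> to \<open>v\<close>.\<close>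

definition orientation_of :: "'a graph \<Rightarrow> ('a \<times> 'a) set \<Rightarrow> bool" where
  "orientation_of G D \<longleftrightarrow>
     (\<forall>(u, v) \<in> D. {u, v} \<in> edges G) \<and>
     (\<forall>u v. {u, v} \<in> edges G \<longrightarrow> ((u, v) \<in> D) \<noteq> ((v, u) \<in> D))"

definition acyclic_orientation :: "'a graph \<Rightarrow> ('a \<times> 'a) set \<Rightarrow> bool" where
  "acyclic_orientation G D \<longleftrightarrow> orientation_of G D \<and> acyclic D"

definition h_number :: "'a graph \<Rightarrow> ('a \<times> 'a) set \<Rightarrow> nat \<Rightarrow> nat" where
  "h_number G D i = card {v \<in> nodes G. card {u. (u, v) \<in> D} = i}"

definition H_sum :: "nat \<Rightarrow> 'a graph \<Rightarrow> nat \<Rightarrow> ('a \<times> 'a) set \<Rightarrow> nat" where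
  "H_sum d G k D = (\<Sum>i = 0..d. h_number G D i * (i choose k))"

section \<open>Frames and systems\<close>

definition k_frame :: "nat \<Rightarrow> 'a graph \<Rightarrow> 'a graph \<Rightarrow> bool" where
  "k_frame k G T \<longleftrightarrow> subgraph_of T G \<and> graph_isomorphic T (star_graph k)"

definition k_system :: "nat \<Rightarrow> 'a graph \<Rightarrow> 'a set set \<Rightarrow> bool" where
  "k_system k G \<S> \<longleftrightarrow>
     (\<forall>S \<in> \<S>. S \<noteq> {} \<and> S \<subseteq> nodes G \<and> regular_graph k (induced_subgraph G S)) \<and>
     (\<forall>T. k_frame k G T \<longrightarrow> (\<exists>!S. S \<in> \<S> \<and> nodes T \<subseteq> S))"

section \<open>Polytopes\<close>

definition vertices :: "'a::euclidean_space set \<Rightarrow> 'a set" where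
  "vertices P = {v. v extreme_point_of P}"

definition simple_polytope :: "nat \<Rightarrow> 'a::euclidean_space set \<Rightarrow> bool" where
  "simple_polytope d P \<longleftrightarrow>
     polytope P \<and> aff_dim P = int d \<and>
     (\<forall>v \<in> vertices P. card {e. e edge_of P \<and> v \<in> e} = d)"

text \<open>An edge of the polytope is a segment; as an edge of the graph it is the set of its two end
  points, which are its extreme points.\<close>

definition polytope_graph :: "'a::euclidean_space set \<Rightarrow> 'a graph" where
  "polytope_graph P = (vertices P, {vertices e | e. e edge_of P})"

definition face_vertex_sets :: "nat \<Rightarrow> 'a::euclidean_space set \<Rightarrow> 'a set set" where
  "face_vertex_sets k P = {vertices F | F. F face_of P \<and> aff_dim F = int k}"

end

theory Submission
  imports Defs
begin

text \<open>For an acyclic orientation, \<open>H\<^sub>k\<close> counts the inward \<open>k\<close>-frames. Every member of a \<open>k\<close>-system has a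
  sink and hence contains an inward \<open>k\<close>-frame, which determines it; so every \<open>k\<close>-system has at most
  \<open>H\<^sub>k\<close> members, with equality exactly if all sinks are unique. The \<open>k\<close>-faces of a simple polytope form
  a \<open>k\<close>-system whose members have unique sinks under every generic linear functional, so they form
  a largest \<open>k\<close>-system. Conversely, the members of a largest \<open>k\<close>-system have unique sinks for all
  these functionals, and a suitable choice of the functional shows that they are \<open>k\<close>-faces.\<close>

section \<open>Systems and acyclic orientations of graphs\<close>

definition nbrs :: "'a graph \<Rightarrow> 'a \<Rightarrow> 'a set" where
  "nbrs G v = {u. u \<noteq> v \<and> {v, u} \<in> edges G}"

definition in_nbrs :: "('a \<times> 'a) set \<Rightarrow> 'a \<Rightarrow> 'a set" where
  "in_nbrs D v = {u. (u, v) \<in> D}"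

definition sinks :: "'a graph \<Rightarrow> ('a \<times> 'a) set \<Rightarrow> 'a set \<Rightarrow> 'a set" where
  "sinks G D S = {v \<in> S. nbrs G v \<inter> S \<subseteq> in_nbrs D v}"

text \<open>Inward stars are stored as pairs of centre and leaf set, so a vertex with
  \<open>i\<close> incoming arcs contributes \<open>i choose k\<close> of them.\<close>

definition in_frames :: "nat \<Rightarrow> 'a graph \<Rightarrow> ('a \<times> 'a) set \<Rightarrow> ('a \<times> 'a set) set" where
  "in_frames k G D = (SIGMA v:nodes G. {A. A \<subseteq> in_nbrs D v \<and> card A = k})"

locale finite_simple_graph =
  fixes G :: "'a graph"
  assumes finite_nodes: "finite (nodes G)"
    and edge_cases: "e \<in> edges G \<Longrightarrow> \<exists>u v. u \<in> nodes G \<and> v \<in> nodes G \<and> u \<noteq> v \<and> e = {u, v}"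
begin

lemma nbrs_subset_nodes: "nbrs G v \<subseteq> nodes G"
proof
  fix u assume "u \<in> nbrs G v"
  then have "{v, u} \<in> edges G" by (simp add: nbrs_def)
  from edge_cases[OF this] show "u \<in> nodes G" by (auto simp: doubleton_eq_iff)
qed

lemma nbrs_eq: "nbrs G v = {u. {v, u} \<in> edges G}"
proof -
  have "u \<noteq> v" if "{v, u} \<in> edges G" for u
    using edge_cases[OF that] by (auto simp: doubleton_eq_iff)
  then show ?thesis by (auto simp: nbrs_def)
qed

lemma finite_nbrs: "finite (nbrs G v)"
  using finite_nodes nbrs_subset_nodes finite_subset by blast

lemma nbrs_sym: "u \<in> nbrs G v \<longleftrightarrow> v \<in> nbrs G u"
  by (auto simp: nbrs_eq insert_commute)

lemma card_incident_edges:
  assumes "v \<in> S"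
  shows "card {e \<in> edges G. e \<subseteq> S \<and> v \<in> e} = card (nbrs G v \<inter> S)"
proof -
  have "{e \<in> edges G. e \<subseteq> S \<and> v \<in> e} = (\<lambda>u. {v, u}) ` (nbrs G v \<inter> S)"
  proof (intro set_eqI iffI)
    fix e assume e: "e \<in> {e \<in> edges G. e \<subseteq> S \<and> v \<in> e}"
    then obtain x y where "e = {x, y}" using edge_cases by blast
    then obtain u where "e = {v, u}" using e by auto
    then show "e \<in> (\<lambda>u. {v, u}) ` (nbrs G v \<inter> S)" using e by (auto simp: nbrs_eq)
  next
    fix e assume "e \<in> (\<lambda>u. {v, u}) ` (nbrs G v \<inter> S)"
    then show "e \<in> {e \<in> edges G. e \<subseteq> S \<and> v \<in> e}" using assms by (auto simp: nbrs_eq)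
  qed
  moreover have "inj_on (\<lambda>u. {v, u}) (nbrs G v \<inter> S)"
    by (auto simp: inj_on_def doubleton_eq_iff)
  ultimately show ?thesis by (simp add: card_image)
qed

lemma regular_induced_subgraph_iff:
  "regular_graph k (induced_subgraph G S) \<longleftrightarrow> (\<forall>v\<in>S. card (nbrs G v \<inter> S) = k)"
  by (simp add: regular_graph_def induced_subgraph_def card_incident_edges conj_assoc)

section \<open>Frames as a centre together with \<open>k\<close> of its neighbours\<close>

lemma k_frame_obtains_center:
  assumes "k_frame k G T"
  obtains v A where "v \<in> nodes G" "A \<subseteq> nbrs G v" "card A = k" "nodes T = insert v A"
proof -
  obtain f where f: "bij_betw f (nodes T) {0..k}"
    and fe: "(\<lambda>e. f ` e) ` edges T = {{0, i} | i. i \<in> {1..k}}"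
    using assms by (auto simp: k_frame_def graph_isomorphic_def star_graph_def)
  have sub: "nodes T \<subseteq> nodes G" "edges T \<subseteq> edges G" "\<And>e. e \<in> edges T \<Longrightarrow> e \<subseteq> nodes T"
    using assms by (auto simp: k_frame_def subgraph_of_def)
  \<comment> \<open>The inverse isomorphism: \<open>g 0\<close> is the centre, and the values of
    \<open>g\<close> on \<open>{1..k}\<close> are the leaves.\<close>
  define g where "g = inv_into (nodes T) f"
  have g: "bij_betw g {0..k} (nodes T)"
    unfolding g_def by (rule bij_betw_inv_into[OF f])
  have gf: "g (f x) = x" if "x \<in> nodes T" for x
    using f that by (simp add: g_def bij_betw_def)
  have leaf: "g i \<in> nbrs G (g 0)" if i: "i \<in> {1..k}" for i
  proof -
    have "{0, i} \<in> (\<lambda>e. f ` e) ` edges T" unfolding fe using i by blast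
    then obtain e where e: "e \<in> edges T" "f ` e = {0, i}" by (metis imageE)
    have "e = g ` f ` e" using sub(3)[OF e(1)] gf by (force simp: image_image)
    then have "e = {g 0, g i}" using e(2) by simp
    then show ?thesis using e(1) sub(2) by (auto simp: nbrs_eq)
  qed
  have "{0..k} = insert 0 {1..k}" by auto
  then have nT: "nodes T = insert (g 0) (g ` {1..k})"
    using g by (metis bij_betw_imp_surj_on image_insert)
  have "inj_on g {1..k}"
    using g by (rule inj_on_subset[OF bij_betw_imp_inj_on]) auto
  then have "card (g ` {1..k}) = k" by (simp add: card_image)
  moreover have "g 0 \<in> nodes G" using nT sub(1) by blast
  ultimately show thesis using that nT leaf by blast
qed

lemma k_frame_of_nbrs:
  assumes v: "v \<in> nodes G" and A: "A \<subseteq> nbrs G v" "card A = k"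
  obtains T where "k_frame k G T" "nodes T = insert v A"
proof -
  have finA: "finite A" using A(1) finite_nbrs finite_subset by blast
  have vA: "v \<notin> A" using A(1) by (auto simp: nbrs_def)
  obtain h where h: "bij_betw h A {1..k}"
    using finite_same_card_bij[of A "{1..k}"] finA A(2) by auto
  \<comment> \<open>\<open>h\<close> numbers the leaves from 1; the centre takes the node 0 of the
    star.\<close>
  define f where "f = h(v := 0)"
  have hf: "f x = h x" if "x \<in> A" for x using that vA by (auto simp: f_def)
  have "bij_betw f A {1..k}" using h hf by (simp cong: bij_betw_cong)
  then have "bij_betw f (insert v A) (insert (f v) {1..k})"
    using notIn_Un_bij_betw[of v A f "{1..k}"] vA by (simp add: f_def)
  moreover have "insert (f v) {1..k} = {0..k}" by (auto simp: f_def)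
  ultimately have bij: "bij_betw f (insert v A) {0..k}" by simp
  define T where "T = (insert v A, (\<lambda>u. {v, u}) ` A)"
  have "(\<lambda>e. f ` e) ` edges T = (\<lambda>i. {0, i}) ` f ` A"
    using vA by (auto simp: T_def image_image f_def intro!: image_cong)
  also have "f ` A = {1..k}" using \<open>bij_betw f A {1..k}\<close> by (simp add: bij_betw_def)
  also have "(\<lambda>i. {0, i}) ` {1..k} = edges (star_graph k)" by (auto simp: star_graph_def)
  finally have "graph_isomorphic T (star_graph k)"
    unfolding graph_isomorphic_def using bij by (auto simp: T_def star_graph_def)
  moreover have "subgraph_of T G"
    using v A(1) nbrs_subset_nodes by (auto simp: subgraph_of_def T_def nbrs_eq)
  ultimately show thesis using that[of T] by (simp add: k_frame_def T_def)
qed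

text \<open>The condition on a frame mentions only its node set, so frames can be exchanged for
  pairs of a centre and \<open>k\<close> neighbours; isomorphisms with the star do not occur after
  this.\<close>

lemma k_system_iff:
  "k_system k G \<S> \<longleftrightarrow>
    (\<forall>S\<in>\<S>. S \<noteq> {} \<and> S \<subseteq> nodes G \<and> (\<forall>v\<in>S. card (nbrs G v \<inter> S) = k)) \<and>
    (\<forall>v\<in>nodes G. \<forall>A. A \<subseteq> nbrs G v \<longrightarrow> card A = k \<longrightarrow> (\<exists>!S. S \<in> \<S> \<and> insert v A \<subseteq> S))"
proof -
  have "(\<forall>T. k_frame k G T \<longrightarrow> Q (nodes T)) \<longleftrightarrow>
    (\<forall>v\<in>nodes G. \<forall>A. A \<subseteq> nbrs G v \<longrightarrow> card A = k \<longrightarrow> Q (insert v A))" for Q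
  proof (intro iffI ballI allI impI)
    fix v A assume "\<forall>T. k_frame k G T \<longrightarrow> Q (nodes T)" "v \<in> nodes G" "A \<subseteq> nbrs G v" "card A = k"
    then show "Q (insert v A)" using k_frame_of_nbrs by metis
  next
    fix T assume "\<forall>v\<in>nodes G. \<forall>A. A \<subseteq> nbrs G v \<longrightarrow> card A = k \<longrightarrow> Q (insert v A)" "k_frame k G T"
    then show "Q (nodes T)" using k_frame_obtains_center by metis
  qed
  from this[of "\<lambda>N. \<exists>!S. S \<in> \<S> \<and> N \<subseteq> S"] show ?thesis
    by (simp only: k_system_def regular_induced_subgraph_iff)
qed

section \<open>Counting inward frames\<close>

lemma in_nbrs_subset_nbrs: "orientation_of G D \<Longrightarrow> in_nbrs D v \<subseteq> nbrs G v"
  by (auto simp: in_nbrs_def orientation_of_def nbrs_eq insert_commute)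

text \<open>A vertex with \<open>i\<close> incoming arcs is the centre of \<open>i choose k\<close>
  inward frames; the rest is grouping the vertices by indegree.\<close>

lemma H_sum_eq_card_in_frames:
  assumes D: "orientation_of G D" and deg: "\<And>v. v \<in> nodes G \<Longrightarrow> card (nbrs G v) \<le> d"
  shows "H_sum d G k D = card (in_frames k G D)"
proof -
  let ?f = "\<lambda>v. card (in_nbrs D v)"
  have fin: "finite (in_nbrs D v)" for v
    using in_nbrs_subset_nbrs[OF D] finite_nbrs finite_subset by blast
  \<comment> \<open>Indegrees do not exceed \<open>d\<close>, so the groups from 0 to
    \<open>d\<close> exhaust the vertices.\<close>
  have "?f ` nodes G \<subseteq> {0..d}"
    using deg card_mono[OF finite_nbrs in_nbrs_subset_nbrs[OF D]] by (force intro: order_trans)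
  then have "(\<Sum>v\<in>nodes G. ?f v choose k) =
      (\<Sum>i\<in>{0..d}. \<Sum>v\<in>{v\<in>nodes G. ?f v = i}. ?f v choose k)"
    using finite_nodes by (intro sum.group[symmetric]) auto
  also have "\<dots> = H_sum d G k D"
    by (simp add: H_sum_def h_number_def in_nbrs_def)
  finally have "H_sum d G k D = (\<Sum>v\<in>nodes G. ?f v choose k)" ..
  also have "\<dots> = card (in_frames k G D)"
    using finite_nodes fin by (simp add: in_frames_def n_subsets)
  finally show ?thesis .
qed

text \<open>A finite acyclic relation has a well-founded converse. A minimal element of
  \<open>S\<close> for it sends no arc into \<open>S\<close>, so its edges inside \<open>S\<close>
  all point inward.\<close>

lemma sinks_nonempty:
  assumes D: "acyclic_orientation G D" and S: "S \<noteq> {}" "S \<subseteq> nodes G"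
  shows "sinks G D S \<noteq> {}"
proof -
  have o: "orientation_of G D" and "acyclic D" using D by (auto simp: acyclic_orientation_def)
  have "D \<subseteq> nodes G \<times> nodes G"
    using in_nbrs_subset_nbrs[OF o] nbrs_subset_nodes nbrs_sym
    by (fastforce simp: in_nbrs_def)
  then have "finite D" using finite_nodes finite_subset by blast
  then have "wf (D\<inverse>)" using \<open>acyclic D\<close> by (rule finite_acyclic_wf_converse)
  then obtain v where v: "v \<in> S" "\<And>u. (v, u) \<in> D \<Longrightarrow> u \<notin> S"
    using S(1) by (metis converse_iff wfE_min ex_in_conv)
  have "u \<in> in_nbrs D v" if "u \<in> nbrs G v \<inter> S" for u
    using o v(2) that by (auto simp: orientation_of_def in_nbrs_def nbrs_eq)
  then show ?thesis using v(1) by (auto simp: sinks_def)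
qed

text \<open>Every member \<open>S\<close> of the system has a sink, and the sink with its neighbours in \<open>S\<close> is an
  inward frame that determines \<open>S\<close>. Sending an inward frame to the member containing it
  therefore maps onto the system, and it is injective exactly when sinks are unique.\<close>

lemma
  assumes D: "acyclic_orientation G D" and sys: "k_system k G \<S>"
  shows k_system_card_le: "card \<S> \<le> card (in_frames k G D)"
    and k_system_card_eq_iff:
      "card \<S> = card (in_frames k G D) \<longleftrightarrow> (\<forall>S\<in>\<S>. \<exists>!v. v \<in> sinks G D S)"
proof -
  let ?F = "in_frames k G D"
  have o: "orientation_of G D" using D by (auto simp: acyclic_orientation_def)
  have S: "S \<noteq> {}" "S \<subseteq> nodes G" "\<And>v. v \<in> S \<Longrightarrow> card (nbrs G v \<inter> S) = k" if "S \<in> \<S>" for S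
    using sys that by (auto simp: k_system_iff)
  have ex1: "\<exists>!S. S \<in> \<S> \<and> insert v A \<subseteq> S"
    if "v \<in> nodes G" "A \<subseteq> nbrs G v" "card A = k" for v A
    using sys that by (auto simp: k_system_iff)
  \<comment> \<open>The member containing the frame; \<open>ex1\<close> makes the description well
    defined on \<open>?F\<close>.\<close>
  define \<phi> where "\<phi> = (\<lambda>(v, A). THE S. S \<in> \<S> \<and> insert v A \<subseteq> S)"
  have \<phi>: "\<phi> (v, A) \<in> \<S>" "insert v A \<subseteq> \<phi> (v, A)" if "(v, A) \<in> ?F" for v A
    using theI'[OF ex1, of v A] that in_nbrs_subset_nbrs[OF o]
    by (auto simp: in_frames_def \<phi>_def)
  have \<phi>_eq: "\<phi> (v, A) = S" if "(v, A) \<in> ?F" "S \<in> \<S>" "insert v A \<subseteq> S" for v A S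
    unfolding \<phi>_def prod.case
    by (rule the1_equality[OF ex1]) (use that in_nbrs_subset_nbrs[OF o] in \<open>auto simp: in_frames_def\<close>)
  have sink_frame: "(v, nbrs G v \<inter> S) \<in> ?F" "\<phi> (v, nbrs G v \<inter> S) = S"
    if "S \<in> \<S>" "v \<in> sinks G D S" for S v
  proof -
    show *: "(v, nbrs G v \<inter> S) \<in> ?F"
      using that S(2,3)[OF that(1)] by (auto simp: in_frames_def sinks_def)
    show "\<phi> (v, nbrs G v \<inter> S) = S"
      using \<phi>_eq[OF * that(1)] that(2) by (auto simp: sinks_def)
  qed
  have frame_sink: "A = nbrs G v \<inter> \<phi> (v, A)" "v \<in> sinks G D (\<phi> (v, A))"
    if "(v, A) \<in> ?F" for v A
  proof -
    have v: "v \<in> \<phi> (v, A)" using \<phi>(2)[OF that] by simp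
    \<comment> \<open>\<open>A\<close> has \<open>k\<close> elements and the member is
      \<open>k\<close>-regular at \<open>v\<close>, so the leaves are all the neighbours of
      \<open>v\<close> there, which makes \<open>v\<close> a sink.\<close>
    show eq: "A = nbrs G v \<inter> \<phi> (v, A)"
    proof (rule card_subset_eq)
      show "A \<subseteq> nbrs G v \<inter> \<phi> (v, A)"
        using that \<phi>(2)[OF that] in_nbrs_subset_nbrs[OF o] by (auto simp: in_frames_def)
      show "card A = card (nbrs G v \<inter> \<phi> (v, A))"
        using that S(3)[OF \<phi>(1)[OF that] v] by (simp add: in_frames_def)
    qed (simp add: finite_nbrs)
    show "v \<in> sinks G D (\<phi> (v, A))"
      using that eq v by (auto simp: sinks_def in_frames_def)
  qed
  have "?F \<subseteq> nodes G \<times> Pow (nodes G)"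
    using in_nbrs_subset_nbrs[OF o] nbrs_subset_nodes by (fastforce simp: in_frames_def)
  then have fin: "finite ?F" using finite_nodes finite_subset by blast
  have im: "\<phi> ` ?F = \<S>"
  proof
    show "\<phi> ` ?F \<subseteq> \<S>" using \<phi>(1) by auto
    show "\<S> \<subseteq> \<phi> ` ?F"
    proof
      fix T assume T: "T \<in> \<S>"
      then obtain v where "v \<in> sinks G D T" using sinks_nonempty[OF D S(1,2)] by blast
      then show "T \<in> \<phi> ` ?F" using sink_frame[OF T] by (metis image_eqI)
    qed
  qed
  show "card \<S> \<le> card ?F" using card_image_le[OF fin, of \<phi>] im by simp
  \<comment> \<open>\<open>\<phi>\<close> maps the finite set \<open>?F\<close> onto
    \<open>\<S>\<close>, so the cardinalities agree exactly if it is injective; the fibre over a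
    member corresponds to its sinks.\<close>
  have "card \<S> = card ?F \<longleftrightarrow> inj_on \<phi> ?F"
    using im fin by (metis card_image eq_card_imp_inj_on)
  also have "\<dots> \<longleftrightarrow> (\<forall>S\<in>\<S>. \<exists>!v. v \<in> sinks G D S)"
  proof
    assume inj: "inj_on \<phi> ?F"
    show "\<forall>S\<in>\<S>. \<exists>!v. v \<in> sinks G D S"
    proof
      fix T assume T: "T \<in> \<S>"
      have "v = w" if "v \<in> sinks G D T" "w \<in> sinks G D T" for v w
        using inj_onD[OF inj _ sink_frame(1)[OF T that(1)] sink_frame(1)[OF T that(2)]]
          sink_frame(2)[OF T that(1)] sink_frame(2)[OF T that(2)] by simp
      then show "\<exists>!v. v \<in> sinks G D T" using sinks_nonempty[OF D S(1,2)[OF T]] by blast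
    qed
  next
    assume u: "\<forall>S\<in>\<S>. \<exists>!v. v \<in> sinks G D S"
    show "inj_on \<phi> ?F"
    proof (rule inj_onI, clarify)
      fix v A w B
      assume vA: "(v, A) \<in> ?F" and wB: "(w, B) \<in> ?F" and eq: "\<phi> (v, A) = \<phi> (w, B)"
      have "v = w"
        using u \<phi>(1)[OF vA] frame_sink(2)[OF vA] frame_sink(2)[OF wB] eq by metis
      moreover have "A = B"
        using frame_sink(1)[OF vA] frame_sink(1)[OF wB] eq \<open>v = w\<close> by simp
      ultimately show "v = w \<and> A = B" ..
    qed
  qed
  finally show "card \<S> = card ?F \<longleftrightarrow> (\<forall>S\<in>\<S>. \<exists>!v. v \<in> sinks G D S)" .
qed

end

section \<open>Graphs of polytopes\<close>

lemma nodes_polytope_graph [simp]: "nodes (polytope_graph P) = vertices P"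
  by (simp add: polytope_graph_def)

lemma vertices_face: "F face_of P \<Longrightarrow> vertices F = vertices P \<inter> F"
  by (auto simp: vertices_def extreme_point_of_face)

lemma vertices_closed_segment: "vertices (closed_segment u v) = {u, v}"
  for u v :: "'a::euclidean_space"
  by (auto simp: vertices_def extreme_point_of_segment)

lemma finite_vertices: "polytope P \<Longrightarrow> finite (vertices P)"
  unfolding vertices_def using finite_polyhedron_extreme_points polytope_imp_polyhedron by blast

lemma convex_hull_vertices: "polytope P \<Longrightarrow> convex hull (vertices P) = P"
  for P :: "'a::euclidean_space set"
  unfolding vertices_def
  using Krein_Milman_Minkowski polytope_imp_compact polytope_imp_convex by blast

lemma edge_of_face: "F face_of P \<Longrightarrow> e edge_of F \<longleftrightarrow> e edge_of P \<and> e \<subseteq> F"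
  by (auto simp: edge_of_def face_of_face)

lemma edge_of_polytope_segment:
  fixes P :: "'a::euclidean_space set"
  assumes P: "polytope P" and e: "e edge_of P"
  obtains u v where "u \<noteq> v" "u \<in> vertices P" "v \<in> vertices P" "e = closed_segment u v"
proof -
  have f: "e face_of P" "aff_dim e = 1" using e by (auto simp: edge_of_def)
  then have pe: "polytope e" using P face_of_polytope_polytope by blast
  have "e \<noteq> {}" "collinear e" using f(2) by (auto simp: collinear_aff_dim)
  then obtain u v where uv: "e = closed_segment u v"
    using compact_convex_collinear_segment pe polytope_imp_compact polytope_imp_convex by metis
  have "u \<noteq> v" using uv f(2) by auto
  moreover have "u \<in> vertices P" "v \<in> vertices P"
    using vertices_face[OF f(1)] vertices_closed_segment uv by blast+
  ultimately show thesis using that uv by blast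
qed

lemma finite_simple_graph_polytope:
  fixes P :: "'a::euclidean_space set"
  assumes "polytope P"
  shows "finite_simple_graph (polytope_graph P)"
proof
  show "finite (nodes (polytope_graph P))" by (simp add: finite_vertices assms)
next
  fix e assume "e \<in> edges (polytope_graph P)"
  then obtain e' where e': "e' edge_of P" "e = vertices e'" by (auto simp: polytope_graph_def)
  show "\<exists>u v. u \<in> nodes (polytope_graph P) \<and> v \<in> nodes (polytope_graph P) \<and> u \<noteq> v \<and> e = {u, v}"
    using edge_of_polytope_segment[OF assms e'(1)] e'(2) vertices_closed_segment by (metis nodes_polytope_graph)
qed

text \<open>A segment is the convex hull of its end points, so replacing edges by pairs of vertices
  loses nothing.\<close>

lemma nbrs_polytope_graph:
  fixes P :: "'a::euclidean_space set"
  assumes P: "polytope P"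
  shows "nbrs (polytope_graph P) v = {u. closed_segment v u edge_of P}"
proof -
  have "{v, u} \<in> edges (polytope_graph P) \<longleftrightarrow> closed_segment v u edge_of P" for u
  proof
    assume "{v, u} \<in> edges (polytope_graph P)"
    then obtain e where e: "e edge_of P" "{v, u} = vertices e" by (auto simp: polytope_graph_def)
    then obtain x y where "e = closed_segment x y" using edge_of_polytope_segment[OF P] by metis
    then have "e = closed_segment v u"
      using e(2) by (metis vertices_closed_segment segment_convex_hull)
    then show "closed_segment v u edge_of P" using e(1) by simp
  next
    assume "closed_segment v u edge_of P"
    then show "{v, u} \<in> edges (polytope_graph P)"
      using vertices_closed_segment by (fastforce simp: polytope_graph_def)
  qed
  then show ?thesis by (simp add: finite_simple_graph.nbrs_eq[OF finite_simple_graph_polytope[OF P]])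
qed

lemma nbrs_face:
  fixes P :: "'a::euclidean_space set"
  assumes P: "polytope P" and F: "F face_of P" and v: "v \<in> F"
  shows "nbrs (polytope_graph F) v = nbrs (polytope_graph P) v \<inter> F"
proof -
  have pF: "polytope F" using F P face_of_polytope_polytope by blast
  then have "closed_segment v u \<subseteq> F \<longleftrightarrow> u \<in> F" for u
    using v polytope_imp_convex convex_contains_segment by blast
  then show ?thesis
    by (auto simp: nbrs_polytope_graph[OF P] nbrs_polytope_graph[OF pF] edge_of_face[OF F])
qed

text \<open>Carries the edge count in the definition of simplicity over to degrees in the graph. An
  edge through the vertex \<open>v\<close> ends at \<open>v\<close>, because \<open>v\<close>
  remains extreme in that edge.\<close>

lemma card_nbrs_polytope_graph:
  fixes P :: "'a::euclidean_space set"
  assumes P: "polytope P" and v: "v \<in> vertices P"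
  shows "card (nbrs (polytope_graph P) v) = card {e. e edge_of P \<and> v \<in> e}"
proof -
  have "bij_betw (closed_segment v) (nbrs (polytope_graph P) v) {e. e edge_of P \<and> v \<in> e}"
    unfolding bij_betw_def
  proof
    show "inj_on (closed_segment v) (nbrs (polytope_graph P) v)"
      by (intro inj_onI) (metis vertices_closed_segment doubleton_eq_iff)
    show "closed_segment v ` nbrs (polytope_graph P) v = {e. e edge_of P \<and> v \<in> e}"
    proof (intro set_eqI iffI)
      fix e assume e: "e \<in> {e. e edge_of P \<and> v \<in> e}"
      then obtain x y where xy: "e = closed_segment x y" "x \<noteq> y"
        using edge_of_polytope_segment[OF P] by blast
      have "v \<in> vertices e" using e v vertices_face by (auto simp: edge_of_def)
      then have "v = x \<or> v = y" using xy vertices_closed_segment by blast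
      then obtain u where "e = closed_segment v u" using xy closed_segment_commute by metis
      then show "e \<in> closed_segment v ` nbrs (polytope_graph P) v"
        using e by (auto simp: nbrs_polytope_graph[OF P])
    qed (auto simp: nbrs_polytope_graph[OF P])
  qed
  then show ?thesis by (rule bij_betw_same_card)
qed

section \<open>Hyperplane sections and the edge cone at a vertex\<close>

lemma exposed_face_functional:
  fixes P :: "'a::euclidean_space set"
  assumes "polytope P" "F face_of P"
  obtains a b where "\<And>x. x \<in> F \<Longrightarrow> a \<bullet> x = b" "\<And>x. x \<in> P - F \<Longrightarrow> a \<bullet> x < b"
proof -
  have "F exposed_face_of P"
    using assms exposed_face_of_polyhedron polytope_imp_polyhedron by blast
  then obtain a b where "P \<subseteq> {x. a \<bullet> x \<le> b}" "F = P \<inter> {x. a \<bullet> x = b}"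
    by (auto simp: exposed_face_of_def)
  then show thesis using that[of a b] by force
qed

text \<open>An extreme point of a hyperplane section of \<open>P\<close> cannot lie in the relative interior of a face
  of dimension at least two, since the hyperplane meets such a face in a segment around it.\<close>

lemma extreme_point_of_hyperplane_section:
  fixes P :: "'a::euclidean_space set"
  assumes P: "polytope P" and x: "x extreme_point_of (P \<inter> {z. a \<bullet> z = b})"
  obtains F where "F face_of P" "x \<in> F" "aff_dim F \<le> 1"
proof -
  have xP: "x \<in> P" "a \<bullet> x = b" using x by (auto simp: extreme_point_of_def)
  let ?Q = "\<lambda>F. F face_of P \<and> x \<in> F"
  have "?Q P" using xP P polytope_imp_convex face_of_refl by blast
  \<comment> \<open>A face of least dimension through \<open>x\<close>: outside its relative
    interior, \<open>x\<close> would lie in a facet of smaller dimension. Nonempty faces have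
    nonnegative dimension, so \<open>nat\<close> loses nothing.\<close>
  then obtain F where F: "?Q F" and min: "\<And>F'. ?Q F' \<Longrightarrow> nat (aff_dim F) \<le> nat (aff_dim F')"
    using ex_has_least_nat[of ?Q P "\<lambda>F. nat (aff_dim F)"] by blast
  have pF: "polytope F" using F P face_of_polytope_polytope by blast
  have "x \<in> rel_interior F"
  proof (rule ccontr)
    assume "x \<notin> rel_interior F"
    then obtain F' where F': "F' facet_of F" "x \<in> F'"
      using F rel_boundary_of_polyhedron[OF polytope_imp_polyhedron[OF pF]] by blast
    then have "F' face_of P" using F face_of_trans facet_of_imp_face_of by blast
    then have "nat (aff_dim F) \<le> nat (aff_dim F')" using min F' by blast
    moreover have "aff_dim F' = aff_dim F - 1" "F' \<noteq> {}" using F' by (auto simp: facet_of_def)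
    moreover have "\<not> aff_dim F' < 0" using \<open>F' \<noteq> {}\<close> by (simp add: aff_dim_negative_iff)
    ultimately show False by linarith
  qed
  then obtain \<epsilon> where \<epsilon>: "\<epsilon> > 0" "ball x \<epsilon> \<inter> affine hull F \<subseteq> F" by (auto simp: mem_rel_interior_ball)
  have "aff_dim F \<le> 1"
  proof (rule ccontr)
    assume dim: "\<not> aff_dim F \<le> 1"
    let ?H = "affine hull F \<inter> {z. a \<bullet> z = b}"
    have xH: "x \<in> ?H" using F xP hull_inc by fastforce
    then have "aff_dim ?H > 0"
      using dim aff_dim_affine_Int_hyperplane[OF affine_affine_hull, of F a b] by auto
    then have "?H \<noteq> {x}" using aff_dim_eq_0 by force
    then obtain y where y: "y \<in> ?H" "y \<noteq> x" using xH by blast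
    \<comment> \<open>The factor makes \<open>norm w\<close> equal to \<open>\<epsilon> / 2\<close>,
      so \<open>x + w\<close> and \<open>x - w\<close> both stay in the ball.\<close>
    define t where "t = \<epsilon> / (2 * norm (y - x))"
    define w where "w = t *\<^sub>R (y - x)"
    have "t > 0" using \<epsilon>(1) y(2) by (simp add: t_def)
    have w: "w \<noteq> 0" "norm w < \<epsilon>" "a \<bullet> w = 0"
      using \<epsilon>(1) y xP by (auto simp: w_def t_def inner_diff_right)
    have "x + s *\<^sub>R w \<in> P \<inter> {z. a \<bullet> z = b}" if "s = 1 \<or> s = -1" for s :: real
    proof -
      have "x + s *\<^sub>R w = (1 - s * t) *\<^sub>R x + (s * t) *\<^sub>R y" by (simp add: w_def algebra_simps)
      then have "x + s *\<^sub>R w \<in> affine hull F"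
        using xH y by (metis IntD1 affine_affine_hull mem_affine diff_add_cancel)
      moreover have "x + s *\<^sub>R w \<in> ball x \<epsilon>" using w(2) that by (auto simp: dist_norm)
      ultimately have "x + s *\<^sub>R w \<in> P" using \<epsilon>(2) F face_of_imp_subset by blast
      then show ?thesis using w(3) xP by (simp add: inner_add_right)
    qed
    from this[of 1] this[of "-1"]
    have "x + w \<in> P \<inter> {z. a \<bullet> z = b}" "x - w \<in> P \<inter> {z. a \<bullet> z = b}" by auto
    moreover have "x \<in> open_segment (x - w) (x + w)"
    proof -
      have "x = midpoint (x - w) (x + w)"
        by (simp add: midpoint_def flip: scaleR_add_left)
      moreover have "x - w \<noteq> x + w"
      proof
        assume "x - w = x + w"
        then have "2 *\<^sub>R w = 0" by (simp add: scaleR_2 algebra_simps)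
        then show False using w(1) by simp
      qed
      ultimately show ?thesis by (metis midpoint_in_open_segment)
    qed
    ultimately show False using x by (auto simp: extreme_point_of_def)
  qed
  then show thesis using that F by blast
qed

text \<open>Cut \<open>P\<close> by a hyperplane separating \<open>v\<close> from the other vertices: the extreme points of the
  section lie on edges, and only the edges at \<open>v\<close> cross the hyperplane.\<close>

lemma polytope_subset_edge_cone:
  fixes P :: "'a::euclidean_space set"
  assumes P: "polytope P" and v: "v \<in> vertices P" and y: "y \<in> P"
  obtains t where "\<And>u. u \<in> nbrs (polytope_graph P) v \<Longrightarrow> t u \<ge> 0"
    "y - v = (\<Sum>u \<in> nbrs (polytope_graph P) v. t u *\<^sub>R (u - v))"
proof -
  let ?N = "nbrs (polytope_graph P) v"
  interpret finite_simple_graph "polytope_graph P" by (rule finite_simple_graph_polytope[OF P])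
  \<comment> \<open>The cone with apex \<open>v\<close> generated by the edges at \<open>v\<close>;
    being convex, it contains \<open>P\<close> once it contains all vertices.\<close>
  define C where "C = {y. \<exists>t. (\<forall>u\<in>?N. 0 \<le> t u) \<and> y - v = (\<Sum>u\<in>?N. t u *\<^sub>R (u - v))}"
  have CI: "y \<in> C" if "\<forall>u\<in>?N. 0 \<le> t u" "y - v = (\<Sum>u\<in>?N. t u *\<^sub>R (u - v))" for y t
    using that by (auto simp: C_def)
  have CE: "\<exists>t. (\<forall>u\<in>?N. 0 \<le> t u) \<and> y - v = (\<Sum>u\<in>?N. t u *\<^sub>R (u - v))" if "y \<in> C" for y
    using that by (simp only: C_def mem_Collect_eq)
  have conv: "convex C"
  proof (rule convexI)
    fix y z :: 'a and \<alpha> \<beta> :: real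
    assume yz: "y \<in> C" "z \<in> C" and c: "0 \<le> \<alpha>" "0 \<le> \<beta>" "\<alpha> + \<beta> = 1"
    obtain t where t: "\<forall>u\<in>?N. 0 \<le> t u" "y - v = (\<Sum>u\<in>?N. t u *\<^sub>R (u - v))"
      using CE[OF yz(1)] by (elim exE conjE)
    obtain s where s: "\<forall>u\<in>?N. 0 \<le> s u" "z - v = (\<Sum>u\<in>?N. s u *\<^sub>R (u - v))"
      using CE[OF yz(2)] by (elim exE conjE)
    have "\<alpha> *\<^sub>R y + \<beta> *\<^sub>R z - v = \<alpha> *\<^sub>R (y - v) + \<beta> *\<^sub>R (z - v)"
      using c(3) by (simp add: algebra_simps flip: scaleR_add_left)
    also have "\<dots> = (\<Sum>u\<in>?N. (\<alpha> * t u + \<beta> * s u) *\<^sub>R (u - v))"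
      by (simp add: t s scaleR_sum_right sum.distrib scaleR_add_left)
    finally show "\<alpha> *\<^sub>R y + \<beta> *\<^sub>R z \<in> C" using t(1) s(1) c by (intro CI) auto
  qed
  have scale: "v + r *\<^sub>R (y - v) \<in> C" if y: "y \<in> C" "r \<ge> 0" for y r
  proof -
    obtain t where t: "\<forall>u\<in>?N. 0 \<le> t u" "y - v = (\<Sum>u\<in>?N. t u *\<^sub>R (u - v))"
      using CE[OF y(1)] by (elim exE conjE)
    then show ?thesis using y(2) by (intro CI[of "\<lambda>u. r * t u"]) (auto simp: scaleR_sum_right)
  qed
  have nbr: "u \<in> C" if "u \<in> ?N" for u
  proof (rule CI[of "\<lambda>w. if w = u then 1 else 0"])
    show "u - v = (\<Sum>w\<in>?N. (if w = u then 1 else 0) *\<^sub>R (w - v))"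
      using that finite_nbrs by (simp add: if_distrib[of "\<lambda>c. c *\<^sub>R _"] sum.delta cong: if_cong)
  qed auto
  have "v \<in> C" by (intro CI[of "\<lambda>_. 0"]) auto
  have "{v} face_of P" using v by (simp add: vertices_def face_of_singleton)
  then obtain a b where ab: "a \<bullet> v = b" "\<And>x. x \<in> P - {v} \<Longrightarrow> a \<bullet> x < b"
    using exposed_face_functional[OF P] by (metis singletonI)
  have VP: "vertices P \<subseteq> P" by (auto simp: vertices_def extreme_point_of_def)
  \<comment> \<open>A level strictly between the values at the other vertices and the maximum at
    \<open>v\<close>; if \<open>v\<close> is the only vertex, any smaller level will do.\<close>
  have "\<exists>m. m < b \<and> (\<forall>x\<in>vertices P - {v}. a \<bullet> x < m)"
  proof (cases "vertices P - {v} = {}")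
    case False
    have fin: "finite ((\<lambda>x. a \<bullet> x) ` (vertices P - {v}))" using finite_vertices[OF P] by simp
    have "Max ((\<lambda>x. a \<bullet> x) ` (vertices P - {v})) < b"
      using False fin ab(2) VP by (subst Max_less_iff) auto
    then obtain m where "Max ((\<lambda>x. a \<bullet> x) ` (vertices P - {v})) < m" "m < b" using dense by blast
    then show ?thesis using False fin by (intro exI[of _ m]) (simp add: Max_less_iff)
  qed (metis empty_iff lt_ex)
  then obtain m where m: "m < b" "\<And>x. x \<in> vertices P - {v} \<Longrightarrow> a \<bullet> x < m" by blast
  let ?Q = "P \<inter> {z. a \<bullet> z = m}"
  have "polytope ?Q" using P polytope_Int_polyhedron polyhedron_hyperplane by blast
  have "vertices ?Q \<subseteq> C"
  proof
    fix x assume x: "x \<in> vertices ?Q"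
    then have x': "x extreme_point_of ?Q" by (simp add: vertices_def)
    then have xm: "x \<in> P" "a \<bullet> x = m" by (auto simp: extreme_point_of_def)
    obtain F where F: "F face_of P" "x \<in> F" "aff_dim F \<le> 1"
      using extreme_point_of_hyperplane_section[OF P x'] .
    have "aff_dim F \<noteq> 0"
    proof
      assume "aff_dim F = 0"
      then have "F = {x}" using F(2) aff_dim_eq_0 by (metis singletonD)
      then have "x \<in> vertices P" using F(1) by (simp add: vertices_def face_of_singleton)
      then show False using m ab(1) xm(2) by (cases "x = v") force+
    qed
    moreover have "\<not> aff_dim F < 0" using F(2) by (auto simp: aff_dim_negative_iff)
    ultimately have "aff_dim F = 1" using F(3) by linarith
    then have e: "F edge_of P" using F(1) by (simp add: edge_of_def)
    then obtain p q where pq: "p \<noteq> q" "p \<in> vertices P" "q \<in> vertices P" "F = closed_segment p q"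
      using edge_of_polytope_segment[OF P] by metis
    \<comment> \<open>An edge with both ends below level \<open>m\<close> lies below it
      altogether.\<close>
    have "v = p \<or> v = q"
    proof (rule ccontr)
      assume "\<not> (v = p \<or> v = q)"
      then have "{p, q} \<subseteq> {z. a \<bullet> z < m}" using m(2) pq by auto
      then have "convex hull {p, q} \<subseteq> {z. a \<bullet> z < m}"
        by (rule hull_minimal) (rule convex_halfspace_lt)
      then show False using F(2) pq(4) xm(2) by (auto simp: segment_convex_hull)
    qed
    then obtain u where u: "F = closed_segment v u" using pq(4) closed_segment_commute by metis
    then have "u \<in> C" using e nbr by (simp add: nbrs_polytope_graph[OF P])
    then show "x \<in> C" using F(2) u conv \<open>v \<in> C\<close> convex_contains_segment by blast
  qed
  then have QC: "?Q \<subseteq> C"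
    using convex_hull_vertices[OF \<open>polytope ?Q\<close>] hull_minimal[of "vertices ?Q" C convex] conv by metis
  have "vertices P \<subseteq> C"
  proof
    fix w assume w: "w \<in> vertices P"
    show "w \<in> C"
    proof (cases "w = v")
      case False
      then have "a \<bullet> w < m" using m(2) w by simp
      \<comment> \<open>The segment from \<open>v\<close> to \<open>w\<close> crosses level
        \<open>m\<close> at parameter \<open>s\<close>; stretching by \<open>1 / s\<close> from
        \<open>v\<close> then leads from the crossing point back to \<open>w\<close>.\<close>
      define s where "s = (b - m) / (b - a \<bullet> w)"
      have s: "0 < s" "s \<le> 1" using m(1) \<open>a \<bullet> w < m\<close> by (auto simp: s_def)
      let ?x = "v + s *\<^sub>R (w - v)"
      have "?x = (1 - s) *\<^sub>R v + s *\<^sub>R w" by (simp add: algebra_simps)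
      then have "?x \<in> P"
        using convexD[OF polytope_imp_convex[OF P], of v w "1 - s" s] s v w VP by auto
      moreover have "a \<bullet> ?x = m"
      proof -
        have "s * (b - a \<bullet> w) = b - m" using m(1) \<open>a \<bullet> w < m\<close> by (simp add: s_def)
        then show ?thesis using ab(1) by (simp add: inner_add_right inner_diff_right algebra_simps)
      qed
      ultimately have "?x \<in> C" using QC by blast
      from scale[OF this, of "1 / s"] show ?thesis using s(1) by simp
    qed (simp add: \<open>v \<in> C\<close>)
  qed
  then have "P \<subseteq> C" using convex_hull_vertices[OF P] hull_minimal[of "vertices P" C convex] conv by metis
  then show thesis using CE[of y] y that by (metis subsetD)
qed

text \<open>Local optimality is global: a functional that increases along no edge at
  \<open>v\<close> increases along no vector of the edge cone, and that cone contains
  \<open>P\<close>.\<close>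

lemma improving_nbr:
  fixes P :: "'a::euclidean_space set"
  assumes P: "polytope P" and v: "v \<in> vertices P" and y: "y \<in> P" "c \<bullet> v < c \<bullet> y"
  obtains u where "u \<in> nbrs (polytope_graph P) v" "c \<bullet> v < c \<bullet> u"
proof -
  obtain t where t: "\<And>u. u \<in> nbrs (polytope_graph P) v \<Longrightarrow> t u \<ge> 0"
    "y - v = (\<Sum>u \<in> nbrs (polytope_graph P) v. t u *\<^sub>R (u - v))"
    using polytope_subset_edge_cone[OF P v y(1)] by metis
  have "\<exists>u\<in>nbrs (polytope_graph P) v. c \<bullet> v < c \<bullet> u"
  proof (rule ccontr)
    assume "\<not> ?thesis"
    then have "(\<Sum>u \<in> nbrs (polytope_graph P) v. t u * (c \<bullet> (u - v))) \<le> 0"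
      using t(1) by (intro sum_nonpos mult_nonneg_nonpos) (auto simp: inner_diff_right)
    also have "(\<Sum>u \<in> nbrs (polytope_graph P) v. t u * (c \<bullet> (u - v))) = c \<bullet> (y - v)"
      by (simp add: t(2) inner_sum_right)
    finally show False using y(2) by (simp add: inner_diff_right)
  qed
  then show thesis using that by blast
qed

lemma polytope_diffs_subset_span:
  fixes P :: "'a::euclidean_space set"
  assumes P: "polytope P" and v: "v \<in> vertices P"
  shows "(\<lambda>y. y - v) ` P \<subseteq> span ((\<lambda>u. u - v) ` nbrs (polytope_graph P) v)"
proof clarify
  fix y assume "y \<in> P"
  then obtain t where "y - v = (\<Sum>u \<in> nbrs (polytope_graph P) v. t u *\<^sub>R (u - v))"
    using polytope_subset_edge_cone[OF P v] by metis
  moreover have "(\<Sum>u \<in> nbrs (polytope_graph P) v. t u *\<^sub>R (u - v))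
      \<in> span ((\<lambda>u. u - v) ` nbrs (polytope_graph P) v)"
    by (intro span_sum span_scale span_base imageI)
  ultimately show "y - v \<in> span ((\<lambda>u. u - v) ` nbrs (polytope_graph P) v)" by simp
qed

section \<open>Faces of simple polytopes\<close>

lemma inj_diff: "inj_on (\<lambda>u. u - v) A" for v :: "'a::group_add"
  by (simp add: inj_on_def)

locale simple_polytope_locale =
  fixes d :: nat and P :: "'a::euclidean_space set"
  assumes simple: "simple_polytope d P"
begin

abbreviation G :: "'a graph" where "G \<equiv> polytope_graph P"

lemma polytope: "polytope P"
  using simple by (simp add: simple_polytope_def)

sublocale finite_simple_graph "polytope_graph P"
  by (rule finite_simple_graph_polytope[OF polytope])

lemma vertices_subset: "vertices P \<subseteq> P"
  by (auto simp: vertices_def extreme_point_of_def)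

lemma nbrs_subset: "nbrs G v \<subseteq> P"
  using nbrs_subset_nodes vertices_subset by auto

lemma card_nbrs: "v \<in> vertices P \<Longrightarrow> card (nbrs G v) = d"
  using simple by (simp add: card_nbrs_polytope_graph[OF polytope] simple_polytope_def)

text \<open>Simplicity enters here: the \<open>d\<close> edge directions at \<open>v\<close> span a
  space of dimension \<open>d\<close>.\<close>

lemma independent_edge_directions:
  assumes v: "v \<in> vertices P"
  shows "independent ((\<lambda>u. u - v) ` nbrs G v)"
proof (rule card_le_dim_spanning)
  show "(\<lambda>u. u - v) ` nbrs G v \<subseteq> (\<lambda>y. y - v) ` P" using nbrs_subset by blast
  show "(\<lambda>y. y - v) ` P \<subseteq> span ((\<lambda>u. u - v) ` nbrs G v)"
    by (rule polytope_diffs_subset_span[OF polytope v])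
  show "finite ((\<lambda>u. u - v) ` nbrs G v)" by (simp add: finite_nbrs)
  have "v \<in> affine hull P" using v vertices_subset by (intro hull_inc) blast
  from aff_dim_eq_dim_subtract[OF this] have "dim ((\<lambda>y. y - v) ` P) = d"
    using simple by (simp add: simple_polytope_def)
  then show "card ((\<lambda>u. u - v) ` nbrs G v) \<le> dim ((\<lambda>y. y - v) ` P)"
    by (simp add: card_image inj_diff card_nbrs[OF v])
qed

text \<open>The directions of the edges of \<open>F\<close> at \<open>v\<close> form a basis: they
  span by the edge cone of \<open>F\<close> itself, and they are independent as part of the
  directions for \<open>P\<close>.\<close>

lemma aff_dim_face:
  assumes F: "F face_of P" and v: "v \<in> vertices P" "v \<in> F"
  shows "aff_dim F = card (nbrs G v \<inter> F)"
proof -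
  let ?B = "(\<lambda>u. u - v) ` (nbrs G v \<inter> F)"
  have pF: "polytope F" using F polytope face_of_polytope_polytope by blast
  have vF: "v \<in> vertices F" using v vertices_face[OF F] by simp
  have "v \<in> affine hull F" using v(2) by (intro hull_inc)
  then have "aff_dim F = dim ((\<lambda>y. y - v) ` F)" by (rule aff_dim_eq_dim_subtract)
  also have "dim ((\<lambda>y. y - v) ` F) = card ?B"
  proof (rule basis_card_eq_dim[symmetric])
    show "?B \<subseteq> (\<lambda>y. y - v) ` F" by blast
    show "(\<lambda>y. y - v) ` F \<subseteq> span ?B"
      using polytope_diffs_subset_span[OF pF vF] by (simp add: nbrs_face[OF polytope F v(2)])
    show "independent ?B"
      using independent_edge_directions[OF v(1)] by (rule independent_mono) blast
  qed
  also have "card ?B = card (nbrs G v \<inter> F)" by (simp add: card_image inj_diff)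
  finally show ?thesis .
qed

text \<open>Since the edge directions at \<open>v\<close> are independent, some linear functional vanishes on those
  belonging to \<open>A\<close> and is negative on the others; it exposes the face spanned by \<open>A\<close>.\<close>

lemma face_spanned_by_edges:
  assumes v: "v \<in> vertices P" and A: "A \<subseteq> nbrs G v"
  obtains F where "F face_of P" "insert v A \<subseteq> F" "aff_dim F = card A"
proof -
  \<comment> \<open>In the condition, \<open>x + v\<close> recovers the neighbour from its
    direction.\<close>
  obtain g :: "'a \<Rightarrow> real" where g: "linear g"
    "\<And>x. x \<in> (\<lambda>u. u - v) ` nbrs G v \<Longrightarrow> g x = (if x + v \<in> A then 0 else -1)"
    using linear_independent_extend[OF independent_edge_directions[OF v],
      of "\<lambda>x. if x + v \<in> A then 0 else (-1::real)"]
    by blast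
  define c where "c = adjoint g 1"
  have c: "c \<bullet> x = g x" for x
    using adjoint_works[OF g(1), of x 1] by (simp add: c_def inner_commute)
  have cu: "c \<bullet> (u - v) = (if u \<in> A then 0 else -1)" if "u \<in> nbrs G v" for u
    using that by (simp add: c g(2))
  \<comment> \<open>No edge at \<open>v\<close> improves \<open>c\<close>, hence \<open>v\<close>
    maximizes \<open>c\<close> on \<open>P\<close> and the hyperplane through \<open>v\<close> is
    supporting.\<close>
  have le: "c \<bullet> y \<le> c \<bullet> v" if y: "y \<in> P" for y
  proof (rule ccontr)
    assume "\<not> c \<bullet> y \<le> c \<bullet> v"
    then obtain u where "u \<in> nbrs G v" "c \<bullet> v < c \<bullet> u"
      using improving_nbr[OF polytope v y] by (metis not_le)
    then show False using cu[of u] by (auto simp: inner_diff_right split: if_splits)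
  qed
  define F where "F = P \<inter> {x. c \<bullet> x = c \<bullet> v}"
  have F: "F face_of P"
    unfolding F_def by (rule face_of_Int_supporting_hyperplane_le[OF polytope_imp_convex[OF polytope] le])
  have vF: "v \<in> F" using v vertices_subset by (auto simp: F_def)
  have "nbrs G v \<inter> F = A"
    using cu nbrs_subset A by (fastforce simp: F_def inner_diff_right split: if_splits)
  then show thesis using that[OF F] aff_dim_face[OF F v vF] vF by auto
qed

text \<open>The intersection of two candidates is a face with at least \<open>card A\<close> edges
  at \<open>v\<close>, so it has the dimension of each and equals both.\<close>

lemma face_spanned_by_edges_unique:
  assumes v: "v \<in> vertices P" and A: "A \<subseteq> nbrs G v"
    and F: "F face_of P" "insert v A \<subseteq> F" "aff_dim F = card A"
    and F': "F' face_of P" "insert v A \<subseteq> F'" "aff_dim F' = card A"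
  shows "F = F'"
proof -
  have sub: "E \<subseteq> E'" if E: "E face_of P" "insert v A \<subseteq> E" "aff_dim E = card A"
    and E': "E' face_of P" "insert v A \<subseteq> E'" for E E'
  proof -
    have I: "(E \<inter> E') face_of P" by (rule face_of_Int[OF E(1) E'(1)])
    have "card A \<le> card (nbrs G v \<inter> (E \<inter> E'))"
      using A E(2) E'(2) finite_nbrs by (intro card_mono) auto
    then have "aff_dim E \<le> aff_dim (E \<inter> E')"
      using E E' aff_dim_face[OF I v] by simp
    moreover have "(E \<inter> E') face_of E" using I by (rule face_of_subset) (use E face_of_imp_subset in auto)
    ultimately have "E \<inter> E' = E"
      using face_of_aff_dim_lt[OF face_of_imp_convex[OF E(1)]] by fastforce
    then show ?thesis by blast
  qed
  show ?thesis using sub[OF F F'(1,2)] sub[OF F' F(1,2)] by blast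
qed

text \<open>Regularity comes from \<open>aff_dim_face\<close>; the frame condition is existence and
  uniqueness of the face spanned by given edges at a vertex.\<close>

lemma k_system_face_vertex_sets: "k_system k G (face_vertex_sets k P)"
  unfolding k_system_iff
proof (intro conjI ballI allI impI)
  fix S assume "S \<in> face_vertex_sets k P"
  then obtain F where F: "S = vertices F" "F face_of P" "aff_dim F = k"
    by (auto simp: face_vertex_sets_def)
  have S: "S = vertices P \<inter> F" using F vertices_face by simp
  have "polytope F" using F(2) polytope face_of_polytope_polytope by blast
  then have "convex hull S = F" using F(1) convex_hull_vertices by blast
  then show "S \<noteq> {}" using F(3) by auto
  show "S \<subseteq> nodes G" using S by simp
  fix v assume v: "v \<in> S"
  have "nbrs G v \<inter> S = nbrs G v \<inter> F" using S nbrs_subset_nodes by auto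
  then show "card (nbrs G v \<inter> S) = k" using aff_dim_face[OF F(2), of v] F(3) v S by simp
next
  fix v A assume v: "v \<in> nodes G" and A: "A \<subseteq> nbrs G v" "card A = k"
  have v': "v \<in> vertices P" using v by simp
  obtain F where F: "F face_of P" "insert v A \<subseteq> F" "aff_dim F = card A"
    using face_spanned_by_edges[OF v' A(1)] .
  show "\<exists>!S. S \<in> face_vertex_sets k P \<and> insert v A \<subseteq> S"
  proof (intro ex1I conjI)
    show "vertices F \<in> face_vertex_sets k P" using F A(2) by (auto simp: face_vertex_sets_def)
    show "insert v A \<subseteq> vertices F"
      using F(2) vertices_face[OF F(1)] v' A(1) nbrs_subset_nodes by auto
  next
    fix S assume S: "S \<in> face_vertex_sets k P \<and> insert v A \<subseteq> S"
    then obtain F' where F': "S = vertices F'" "F' face_of P" "aff_dim F' = k"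
      by (auto simp: face_vertex_sets_def)
    then have "insert v A \<subseteq> F'" using S vertices_face by blast
    then show "S = vertices F"
      using face_spanned_by_edges_unique[OF v' A(1) F F'(2)] F'(1,3) A(2) by simp
  qed
qed

section \<open>Orientations by linear functionals\<close>

text \<open>Arcs point uphill, so sinks are local maxima of the functional.\<close>

definition linear_orientation :: "'a \<Rightarrow> ('a \<times> 'a) set" where
  "linear_orientation c = {(u, v). {u, v} \<in> edges G \<and> c \<bullet> u < c \<bullet> v}"

lemma acyclic_linear_orientation:
  assumes "inj_on ((\<bullet>) c) (vertices P)"
  shows "acyclic_orientation G (linear_orientation c)"
proof -
  have "(u, v) \<in> (linear_orientation c)\<^sup>+ \<Longrightarrow> c \<bullet> u < c \<bullet> v" for u v
    by (induction rule: trancl_induct) (auto simp: linear_orientation_def)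
  then have "acyclic (linear_orientation c)" by (auto simp: acyclic_def)
  moreover have "c \<bullet> u \<noteq> c \<bullet> v" if e: "{u, v} \<in> edges G" for u v
  proof -
    from edge_cases[OF e] have "u \<in> vertices P" "v \<in> vertices P" "u \<noteq> v"
      by (auto simp: doubleton_eq_iff)
    then show ?thesis using assms inj_onD by metis
  qed
  then have "orientation_of G (linear_orientation c)"
    by (fastforce simp: orientation_of_def linear_orientation_def insert_commute)
  ultimately show ?thesis by (simp add: acyclic_orientation_def)
qed

lemma mem_sinks_linear_orientation:
  "v \<in> sinks G (linear_orientation c) S \<longleftrightarrow> v \<in> S \<and> (\<forall>u\<in>nbrs G v \<inter> S. c \<bullet> u < c \<bullet> v)"
  by (auto simp: sinks_def in_nbrs_def linear_orientation_def nbrs_eq insert_commute)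

text \<open>By \<open>improving_nbr\<close> a local maximum on a face is a global one, and
  \<open>c\<close> separates the vertices, so each face has a single sink.\<close>

lemma card_face_vertex_sets:
  assumes c: "inj_on ((\<bullet>) c) (vertices P)"
  shows "card (face_vertex_sets k P) = card (in_frames k G (linear_orientation c))"
  unfolding k_system_card_eq_iff[OF acyclic_linear_orientation[OF c] k_system_face_vertex_sets]
proof
  let ?D = "linear_orientation c"
  fix S assume S: "S \<in> face_vertex_sets k P"
  then obtain F where F: "S = vertices F" "F face_of P" by (auto simp: face_vertex_sets_def)
  have SF: "S = vertices P \<inter> F" using F vertices_face by simp
  have pF: "polytope F" using F(2) polytope face_of_polytope_polytope by blast
  have max: "c \<bullet> w \<le> c \<bullet> v" if "v \<in> sinks G ?D S" "w \<in> S" for v w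
  proof (rule ccontr)
    assume less: "\<not> c \<bullet> w \<le> c \<bullet> v"
    have v: "v \<in> S" using that(1) by (simp add: sinks_def)
    have "w \<in> F" using that(2) SF by blast
    then obtain u where u: "u \<in> nbrs (polytope_graph F) v" "c \<bullet> v < c \<bullet> u"
      using improving_nbr[OF pF, of v w c] less v F(1) by (metis not_le)
    then have "u \<in> nbrs G v \<inter> S"
      using v SF nbrs_subset_nodes by (auto simp: nbrs_face[OF polytope F(2)])
    then show False using that(1) u(2) unfolding mem_sinks_linear_orientation by (meson order_less_asym)
  qed
  have "v = w" if "v \<in> sinks G ?D S" "w \<in> sinks G ?D S" for v w
  proof -
    have "v \<in> S" "w \<in> S" using that by (auto simp: sinks_def)
    then show ?thesis using max that SF inj_onD[OF c] by (metis IntD1 order_antisym)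
  qed
  moreover have "sinks G ?D S \<noteq> {}"
    using S k_system_face_vertex_sets[unfolded k_system_iff]
    by (intro sinks_nonempty[OF acyclic_linear_orientation[OF c]]) auto
  ultimately show "\<exists>!v. v \<in> sinks G ?D S" by blast
qed

end

section \<open>Functionals in general position\<close>

lemma open_avoids_hyperplanes:
  fixes D :: "'a::euclidean_space set"
  assumes "open U" "U \<noteq> {}" "finite D" "0 \<notin> D"
  obtains c where "c \<in> U" "\<And>x. x \<in> D \<Longrightarrow> c \<bullet> x \<noteq> 0"
proof -
  \<comment> \<open>Finitely many hyperplanes form a negligible set, which cannot cover a nonempty
    open one.\<close>
  have "negligible (\<Union>x\<in>D. {c. x \<bullet> c = 0})"
    using assms(3,4) by (intro negligible_Union) (auto intro!: negligible_hyperplane)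
  then have "\<not> U \<subseteq> (\<Union>x\<in>D. {c. x \<bullet> c = 0})"
    using open_not_negligible[OF assms(1,2)] negligible_subset by blast
  then show thesis using that by (fastforce simp: inner_commute)
qed

text \<open>Take \<open>M *\<^sub>R a - a'\<close> with \<open>a\<close> exposing \<open>F\<close>
  and \<open>a'\<close> exposing \<open>v\<close>: on \<open>F\<close> the first term is constant
  and \<open>- a'\<close> is least at \<open>v\<close>; off \<open>F\<close> a large
  \<open>M\<close> makes the first term decisive. A perturbation inside the open set
  \<open>U\<close> then separates all vertices.\<close>

lemma generic_functional:
  fixes P :: "'a::euclidean_space set"
  assumes P: "polytope P" and F: "F face_of P" and v: "v \<in> vertices P" "v \<in> F"
  obtains c where "inj_on ((\<bullet>) c) (vertices P)"
    "\<And>x. x \<in> vertices P \<inter> F \<Longrightarrow> x \<noteq> v \<Longrightarrow> c \<bullet> v < c \<bullet> x"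
    "\<And>x. x \<in> vertices P - F \<Longrightarrow> c \<bullet> x < c \<bullet> v"
proof -
  have VP: "vertices P \<subseteq> P" by (auto simp: vertices_def extreme_point_of_def)
  have fin: "finite (vertices P)" by (rule finite_vertices[OF P])
  obtain a b where a: "\<And>x. x \<in> F \<Longrightarrow> a \<bullet> x = b" "\<And>x. x \<in> P - F \<Longrightarrow> a \<bullet> x < b"
    using exposed_face_functional[OF P F] by metis
  have "{v} face_of P" using v by (simp add: vertices_def face_of_singleton)
  then obtain a' b' where a': "a' \<bullet> v = b'" "\<And>x. x \<in> P - {v} \<Longrightarrow> a' \<bullet> x < b'"
    using exposed_face_functional[OF P] by (metis singletonI)
  define U where "U = (\<Inter>x\<in>vertices P \<inter> F - {v}. {c. c \<bullet> (x - v) > 0}) \<inter>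
    (\<Inter>x\<in>vertices P - F. {c. c \<bullet> (x - v) < 0})"
  have "open U"
    unfolding U_def using fin
    by (intro open_Int open_INT ballI open_Collect_less continuous_intros) auto
  have "\<forall>\<^sub>F M in at_top. \<forall>x\<in>vertices P - F. M * (a \<bullet> (x - v)) < a' \<bullet> (x - v)"
  proof (rule eventually_ball_finite)
    show "finite (vertices P - F)" using fin by blast
    show "\<forall>x\<in>vertices P - F. \<forall>\<^sub>F M in at_top. M * (a \<bullet> (x - v)) < a' \<bullet> (x - v)"
    proof
      fix x assume x: "x \<in> vertices P - F"
      then have neg: "a \<bullet> (x - v) < 0" using a v(2) VP by (auto simp: inner_diff_right)
      have "\<forall>\<^sub>F M in at_top. M > (a' \<bullet> (x - v)) / (a \<bullet> (x - v))" by (rule eventually_gt_at_top)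
      then show "\<forall>\<^sub>F M in at_top. M * (a \<bullet> (x - v)) < a' \<bullet> (x - v)"
        by eventually_elim (use neg in \<open>simp add: field_simps\<close>)
    qed
  qed
  then obtain M where M: "\<And>x. x \<in> vertices P - F \<Longrightarrow> M * (a \<bullet> (x - v)) < a' \<bullet> (x - v)"
    using eventually_happens' trivial_limit_at_top_linorder by blast
  have "M *\<^sub>R a - a' \<in> U"
  proof -
    have "(M *\<^sub>R a - a') \<bullet> (x - v) > 0" if "x \<in> vertices P \<inter> F - {v}" for x
    proof -
      have "a' \<bullet> x < a' \<bullet> v" using that a' VP by auto
      then show ?thesis using a(1) that v(2) by (auto simp: inner_diff_left inner_diff_right)
    qed
    moreover have "(M *\<^sub>R a - a') \<bullet> (x - v) < 0" if "x \<in> vertices P - F" for x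
      using M[OF that] by (simp add: inner_diff_left)
    ultimately show ?thesis by (auto simp: U_def)
  qed
  \<comment> \<open>A functional that vanishes on no difference of distinct vertices is injective on
    them.\<close>
  define D where "D = (\<lambda>(x, y). x - y) ` (vertices P \<times> vertices P - Id)"
  have "finite D" using fin by (simp add: D_def)
  moreover have "0 \<notin> D" by (auto simp: D_def)
  ultimately obtain c where c: "c \<in> U" "\<And>x. x \<in> D \<Longrightarrow> c \<bullet> x \<noteq> 0"
    using open_avoids_hyperplanes[OF \<open>open U\<close>, of D] \<open>M *\<^sub>R a - a' \<in> U\<close> by (metis empty_iff)
  have "inj_on ((\<bullet>) c) (vertices P)"
  proof (rule inj_onI, rule ccontr)
    fix x y assume "x \<in> vertices P" "y \<in> vertices P" "c \<bullet> x = c \<bullet> y" "x \<noteq> y"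
    then have "x - y \<in> D" "c \<bullet> (x - y) = 0"
      by (auto simp: D_def inner_diff_right intro: image_eqI[of _ _ "(x, y)"])
    then show False using c(2) by blast
  qed
  then show thesis using that c(1) by (auto simp: U_def inner_diff_right)
qed

section \<open>Recovering the faces from a largest system\<close>

context simple_polytope_locale
begin

lemma finite_face_vertex_sets: "finite (face_vertex_sets k P)"
proof (rule finite_subset)
  show "face_vertex_sets k P \<subseteq> Pow (vertices P)"
    using k_system_face_vertex_sets[of k, unfolded k_system_iff] by auto
qed (simp add: finite_vertices[OF polytope])

text \<open>Given \<open>v \<in> S\<close>, let \<open>F\<close> be the face spanned by the edges of \<open>S\<close> at \<open>v\<close>, and let \<open>c\<close> be larger
  on \<open>F\<close> than on the remaining vertices, with its minimum over \<open>F\<close> at \<open>v\<close>. Then \<open>v\<close> is a source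
  of \<open>S\<close>; since it is the only one, \<open>S\<close> lies above \<open>v\<close>, that is, in \<open>F\<close>.\<close>

lemma k_system_eq_face_vertex_sets:
  assumes sys: "k_system k G \<S>" and card: "card \<S> = card (face_vertex_sets k P)"
  shows "\<S> = face_vertex_sets k P"
proof (rule card_subset_eq[OF finite_face_vertex_sets _ card], rule subsetI)
  fix S assume S: "S \<in> \<S>"
  then have S': "S \<noteq> {}" "S \<subseteq> vertices P" "\<And>v. v \<in> S \<Longrightarrow> card (nbrs G v \<inter> S) = k"
    using sys by (auto simp: k_system_iff)
  then obtain v where v: "v \<in> S" by blast
  have vP: "v \<in> vertices P" using v S' by blast
  obtain F where F: "F face_of P" "insert v (nbrs G v \<inter> S) \<subseteq> F" "aff_dim F = k"
    using face_spanned_by_edges[OF vP, of "nbrs G v \<inter> S"] S'(3)[OF v] by auto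
  have pF: "polytope F" using F(1) polytope face_of_polytope_polytope by blast
  have vF: "v \<in> F" using F(2) by blast
  obtain c where c: "inj_on ((\<bullet>) c) (vertices P)"
    "\<And>x. x \<in> vertices P \<inter> F \<Longrightarrow> x \<noteq> v \<Longrightarrow> c \<bullet> v < c \<bullet> x"
    "\<And>x. x \<in> vertices P - F \<Longrightarrow> c \<bullet> x < c \<bullet> v"
    using generic_functional[OF polytope F(1) vP vF] by metis
  \<comment> \<open>Negation reverses all arcs, so sources for \<open>c\<close> become
    sinks.\<close>
  let ?D = "linear_orientation (- c)"
  have mc: "inj_on ((\<bullet>) (- c)) (vertices P)" using c(1) by (simp add: inj_on_def)
  have u: "\<exists>!w. w \<in> sinks G ?D S"
    using k_system_card_eq_iff[OF acyclic_linear_orientation[OF mc] sys] S card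
      card_face_vertex_sets[OF mc] by simp
  have vsink: "v \<in> sinks G ?D S"
    using v F(2) c(2) nbrs_subset_nodes by (auto simp: mem_sinks_linear_orientation nbrs_def)
  have SF: "S \<subseteq> F"
  proof
    fix x assume x: "x \<in> S"
    have "finite S" using S'(2) finite_vertices[OF polytope] finite_subset by blast
    \<comment> \<open>The minimum of \<open>c\<close> on \<open>S\<close> is a sink of
      \<open>?D\<close>, as is \<open>v\<close>, so it is \<open>v\<close>; vertices off
      \<open>F\<close> have smaller values than \<open>v\<close>.\<close>
    define w where "w = arg_min_on ((\<bullet>) c) S"
    have w: "w \<in> S" "\<And>y. y \<in> S \<Longrightarrow> c \<bullet> w \<le> c \<bullet> y"
      unfolding w_def by (intro arg_min_if_finite \<open>finite S\<close> S'(1) arg_min_least; assumption)+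
    have "c \<bullet> w < c \<bullet> y" if "y \<in> nbrs G w \<inter> S" for y
    proof -
      have "w \<noteq> y" "w \<in> vertices P" "y \<in> vertices P" using that w(1) S'(2) by (auto simp: nbrs_def)
      then have "c \<bullet> w \<noteq> c \<bullet> y" using inj_onD[OF c(1)] by blast
      then show ?thesis using w(2)[of y] that by simp
    qed
    then have "w \<in> sinks G ?D S" using w(1) by (simp add: mem_sinks_linear_orientation)
    then have "w = v" using u vsink by blast
    then show "x \<in> F" using w(2)[OF x] c(3)[of x] x S'(2) by fastforce
  qed
  have VF: "vertices F = vertices P \<inter> F" by (rule vertices_face[OF F(1)])
  \<comment> \<open>A lowest vertex \<open>w\<close> of \<open>F\<close> outside \<open>S\<close>
    has a lower neighbour \<open>x\<close> in \<open>F\<close>, which lies in \<open>S\<close>.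
    Since \<open>S\<close> lies in \<open>F\<close> and \<open>x\<close> has \<open>k\<close>
    neighbours in each, these neighbours coincide, which puts \<open>w\<close> into
    \<open>S\<close>.\<close>
  have "vertices F \<subseteq> S"
  proof (rule ccontr)
    assume "\<not> vertices F \<subseteq> S"
    then have ne: "vertices F - S \<noteq> {}" by blast
    have fin: "finite (vertices F - S)" using finite_vertices[OF pF] by blast
    define w where "w = arg_min_on ((\<bullet>) c) (vertices F - S)"
    have w: "w \<in> vertices F - S" "\<And>y. y \<in> vertices F - S \<Longrightarrow> c \<bullet> w \<le> c \<bullet> y"
      unfolding w_def by (intro arg_min_if_finite fin ne arg_min_least; assumption)+
    have "c \<bullet> v < c \<bullet> w" using w(1) v c(2) VF by auto
    then obtain x where x: "x \<in> nbrs (polytope_graph F) w" "c \<bullet> x < c \<bullet> w"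
      using improving_nbr[OF pF, of w v "- c"] w(1) vF by auto
    have x': "x \<in> nbrs G w" "x \<in> F" using x(1) w(1) VF by (auto simp: nbrs_face[OF polytope F(1)])
    then have "x \<in> vertices F" using VF nbrs_subset_nodes by auto
    then have xS: "x \<in> S" using w(2)[of x] x(2) by fastforce
    have "nbrs G x \<inter> S = nbrs G x \<inter> F"
    proof (rule card_subset_eq)
      show "card (nbrs G x \<inter> S) = card (nbrs G x \<inter> F)"
        using S'(3)[OF xS] aff_dim_face[OF F(1) _ x'(2)] F(3) xS S'(2) by auto
    qed (use SF finite_nbrs in auto)
    moreover have "w \<in> nbrs G x \<inter> F" using x'(1) nbrs_sym w(1) VF by blast
    ultimately show False using w(1) by blast
  qed
  then have "S = vertices F" using SF S'(2) VF by blast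
  then show "S \<in> face_vertex_sets k P" using F by (auto simp: face_vertex_sets_def)
qed

lemma H_sum_eq:
  assumes "acyclic_orientation G D"
  shows "H_sum d G k D = card (in_frames k G D)"
proof (rule H_sum_eq_card_in_frames)
  show "orientation_of G D" using assms by (simp add: acyclic_orientation_def)
  show "card (nbrs G v) \<le> d" if "v \<in> nodes G" for v using that card_nbrs by simp
qed

lemma generic_functional_exists:
  obtains c where "inj_on ((\<bullet>) c) (vertices P)"
proof (cases "vertices P = {}")
  case False
  then obtain v where "v \<in> vertices P" by blast
  then have "v \<in> P" using vertices_subset by blast
  have "P face_of P" using polytope face_of_refl polytope_imp_convex by blast
  from generic_functional[OF polytope this \<open>v \<in> vertices P\<close> \<open>v \<in> P\<close>] show thesis
    using that by metis
next
  case True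
  then show thesis using that[of 0] by simp
qed

end

theorem corollary3:
  fixes P :: "'a::euclidean_space set" and d k :: nat and \<S> :: "'a set set"
  assumes "simple_polytope d P"
    and "2 \<le> k" and "k \<le> d - 1"
    and "k_system k (polytope_graph P) \<S>"
  shows "((\<exists>D. acyclic_orientation (polytope_graph P) D \<and>
              H_sum d (polytope_graph P) k D = card \<S>) \<noteq>
          (\<exists>\<S>'. k_system k (polytope_graph P) \<S>' \<and> card \<S>' > card \<S>)) \<and>
         ((\<exists>D. acyclic_orientation (polytope_graph P) D \<and>
              H_sum d (polytope_graph P) k D = card \<S>) \<longrightarrow>
          \<S> = face_vertex_sets k P) \<and>
         ((\<exists>\<S>'. k_system k (polytope_graph P) \<S>' \<and> card \<S>' > card \<S>) \<longrightarrow>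
          \<S> \<noteq> face_vertex_sets k P)"
proof -
  interpret simple_polytope_locale d P by standard (rule assms(1))
  let ?V = "face_vertex_sets k P"
  let ?a = "\<exists>D. acyclic_orientation G D \<and> H_sum d G k D = card \<S>"
  let ?b = "\<exists>\<S>'. k_system k G \<S>' \<and> card \<S>' > card \<S>"
  have upper: "card \<T> \<le> H_sum d G k D" if "k_system k G \<T>" "acyclic_orientation G D" for \<T> D
    using k_system_card_le[OF that(2,1)] by (simp add: H_sum_eq[OF that(2)])
  obtain c where c: "inj_on ((\<bullet>) c) (vertices P)" using generic_functional_exists .
  have D: "acyclic_orientation G (linear_orientation c)" "H_sum d G k (linear_orientation c) = card ?V"
    using acyclic_linear_orientation[OF c] card_face_vertex_sets[OF c] H_sum_eq by auto
  \<comment> \<open>The value of \<open>H_sum\<close> at one linear orientation bounds every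
    \<open>k\<close>-system, and the system of faces attains it.\<close>
  have le: "card \<T> \<le> card ?V" if "k_system k G \<T>" for \<T>
    using upper[OF that D(1)] D(2) by simp
  \<comment> \<open>The orientation in (a) bounds the system of faces by \<open>card \<S>\<close>;
    the reverse bound is \<open>le\<close>.\<close>
  have a: "?a \<longleftrightarrow> card \<S> = card ?V"
  proof
    assume ?a
    then show "card \<S> = card ?V"
      using upper[OF k_system_face_vertex_sets] le[OF assms(4)] by (fastforce intro: order_antisym)
  next
    assume "card \<S> = card ?V"
    then show ?a using D by auto
  qed
  have b: "?b \<longleftrightarrow> card \<S> < card ?V"
    using le k_system_face_vertex_sets by (auto intro: less_le_trans)
  have "?a \<noteq> ?b" unfolding a b using le[OF assms(4)] by auto
  moreover have "?a \<longrightarrow> \<S> = ?V" using a k_system_eq_face_vertex_sets[OF assms(4)] by blast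
  moreover have "?b \<longrightarrow> \<S> \<noteq> ?V" using b by blast
  ultimately show ?thesis by blast
qed

end
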